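(* There exists a finite (possibly empty) set $\Delta_2\subset\mathbb C$ such that for every $d^o\in\mathbb C\setminus(\Delta_2\cup\{0\})$, the polynomial $g(d^o,\bar x)$ defines $\mathcal O_{d^o}(\Sigma)$, i.e. the zero set of $g(d^o,\bar x)$ in $\mathbb C^3$ equals $\mathcal O_{d^o}(\Sigma)$.
   Context: Let $f\in\mathbb C[y_1,y_2,y_3]$ be irreducible, defining a surface $\Sigma$; $f_i=\partial f/\partial y_i$, $h_{\rm imp}=\sum f_i^2$, not identically zero on $\Sigma$. Consider the system in $(d,\bar x,\bar y,u)$: $f(\bar y)=0$; $f_i(\bar y)(x_j-y_j)-f_j(\bar y)(x_i-y_i)=0$ ($i<j$); $\sum_i(x_i-y_i)^2-d^2=0$; $u\,h_{\rm imp}(\bar y)-1=0$. The generic offset $\mathcal O_d(\Sigma)\subset\mathbb C^4$ is the Zariski closure of the projection of its solutions to $(d,\bar x)$; it is a hypersurface and $g(d,\bar x)$ denotes its square-free defining polynomial (generic offset polynomial). For $d^o\in\mathbb C\setminus\{0\}$, the offset $\mathcal O_{d^o}(\Sigma)\subset\mathbb C^3$ is the Zariski closure of the projection to $\bar x$ of the solutions $(\bar x,\bar y,u)$ of the same system with $d=d^o$. *)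

theory Defs
  imports "HOL-Computational_Algebra.Computational_Algebra"
begin

text \<open>Polynomials in C[y1,y2,y3] are represented as complex poly poly poly,
  outermost variable y1, innermost y3. Polynomials in C[d,x1,x2,x3] as
  complex poly poly poly poly, outermost variable d.\<close>

definition eval3 :: "complex poly poly poly \<Rightarrow> complex \<Rightarrow> complex \<Rightarrow> complex \<Rightarrow> complex" where
  "eval3 p a b c = poly (poly (poly p [:[:a:]:]) [:b:]) c"

definition eval4 :: "complex poly poly poly poly \<Rightarrow> complex \<Rightarrow> complex \<Rightarrow> complex \<Rightarrow> complex \<Rightarrow> complex" where
  "eval4 p a b c e = eval3 (poly p [:[:[:a:]:]:]) b c e"

definition spec_first :: "complex poly poly poly poly \<Rightarrow> complex \<Rightarrow> complex poly poly poly" where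
  "spec_first g d0 = poly g [:[:[:d0:]:]:]"

definition pd1 :: "complex poly poly poly \<Rightarrow> complex poly poly poly" where
  "pd1 p = pderiv p"
definition pd2 :: "complex poly poly poly \<Rightarrow> complex poly poly poly" where
  "pd2 p = map_poly pderiv p"
definition pd3 :: "complex poly poly poly \<Rightarrow> complex poly poly poly" where
  "pd3 p = map_poly (map_poly pderiv) p"

definition h_imp :: "complex poly poly poly \<Rightarrow> complex poly poly poly" where
  "h_imp f = (pd1 f)^2 + (pd2 f)^2 + (pd3 f)^2"

definition zero_set3 :: "complex poly poly poly \<Rightarrow> (complex \<times> complex \<times> complex) set" where
  "zero_set3 p = {(a,b,c). eval3 p a b c = 0}"

definition zariski_closure3 :: "(complex \<times> complex \<times> complex) set \<Rightarrow> (complex \<times> complex \<times> complex) set" where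
  "zariski_closure3 S = {(a,b,c). \<forall>q. (\<forall>(a',b',c')\<in>S. eval3 q a' b' c' = 0) \<longrightarrow> eval3 q a b c = 0}"

definition zariski_closure4 :: "(complex \<times> complex \<times> complex \<times> complex) set \<Rightarrow> (complex \<times> complex \<times> complex \<times> complex) set" where
  "zariski_closure4 S = {(a,b,c,e). \<forall>q. (\<forall>(a',b',c',e')\<in>S. eval4 q a' b' c' e' = 0) \<longrightarrow> eval4 q a b c e = 0}"

definition offset_system :: "complex poly poly poly \<Rightarrow> complex \<Rightarrow> complex \<Rightarrow> complex \<Rightarrow> complex
    \<Rightarrow> complex \<Rightarrow> complex \<Rightarrow> complex \<Rightarrow> complex \<Rightarrow> bool" where
  "offset_system f d x1 x2 x3 y1 y2 y3 u \<longleftrightarrow>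
     (let f1 = eval3 (pd1 f) y1 y2 y3; f2 = eval3 (pd2 f) y1 y2 y3; f3 = eval3 (pd3 f) y1 y2 y3 in
      eval3 f y1 y2 y3 = 0 \<and>
      f1 * (x2 - y2) - f2 * (x1 - y1) = 0 \<and>
      f1 * (x3 - y3) - f3 * (x1 - y1) = 0 \<and>
      f2 * (x3 - y3) - f3 * (x2 - y2) = 0 \<and>
      (x1 - y1)^2 + (x2 - y2)^2 + (x3 - y3)^2 - d^2 = 0 \<and>
      u * eval3 (h_imp f) y1 y2 y3 - 1 = 0)"

definition generic_offset :: "complex poly poly poly \<Rightarrow> (complex \<times> complex \<times> complex \<times> complex) set" where
  "generic_offset f = zariski_closure4
     {(d,x1,x2,x3). \<exists>y1 y2 y3 u. offset_system f d x1 x2 x3 y1 y2 y3 u}"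

definition offset_at :: "complex poly poly poly \<Rightarrow> complex \<Rightarrow> (complex \<times> complex \<times> complex) set" where
  "offset_at f d0 = zariski_closure3
     {(x1,x2,x3). \<exists>y1 y2 y3 u. offset_system f d0 x1 x2 x3 y1 y2 y3 u}"

end

theory Submission
  imports Defs "HOL-Computational_Algebra.Field_as_Ring"
begin

text \<open>The solutions of the offset system project to a constructible set \<open>S\<close> of points \<open>(d, x)\<close>, by
  quantifier elimination over the complex numbers. For every irreducible factor \<open>p\<close> of \<open>g\<close>, a
  constructible set either contains or misses \<open>Z(p)\<close> outside a hypersurface \<open>Z(b)\<close> with
  \<open>p\<close> not dividing \<open>b\<close>; missing it is impossible for \<open>S\<close>, because \<open>Z(g)\<close> is the Zariski closure of
  \<open>S\<close>. Elimination shows that \<open>p(d0, _)\<close> and \<open>b(d0, _)\<close> have no common factor for all but finitely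
  many \<open>d0\<close>. A polynomial \<open>q\<close> vanishing on the slice of \<open>S\<close> at such a \<open>d0\<close> makes
  \<open>q * b(d0, _)\<close> vanish on the zero set of each irreducible factor of \<open>p(d0, _)\<close>, so by the
  Nullstellensatz for hypersurfaces each of these factors divides \<open>q\<close>.\<close>

section \<open>Projections of constructible sets\<close>

text \<open>Coefficients depending on a parameter \<open>e\<close> are handled as functions of
  \<open>e\<close>. The elimination uses only closure under the ring operations, so it can be
  repeated after a variable has been adjoined.\<close>

locale function_algebra =
  fixes R :: "('e \<Rightarrow> complex) set"
  assumes const: "(\<lambda>_. c) \<in> R"
    and add: "a \<in> R \<Longrightarrow> b \<in> R \<Longrightarrow> (\<lambda>e. a e + b e) \<in> R"
    and mult: "a \<in> R \<Longrightarrow> b \<in> R \<Longrightarrow> (\<lambda>e. a e * b e) \<in> R"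
begin

lemma diff:
  assumes "a \<in> R" "b \<in> R" shows "(\<lambda>e. a e - b e) \<in> R"
  using add[OF assms(1) mult[OF const[of "-1"] assms(2)]] by simp

lemma power: "a \<in> R \<Longrightarrow> (\<lambda>e. a e ^ n) \<in> R"
  by (induction n) (auto intro: const mult)

lemma sum: "(\<And>i. i \<in> I \<Longrightarrow> a i \<in> R) \<Longrightarrow> (\<lambda>e. \<Sum>i\<in>I. a i e) \<in> R"
  by (induction I rule: infinite_finite_induct) (auto intro: const add)

end

text \<open>The bound \<open>n\<close> is strict and need not be sharp; it plays the role of a formal degree plus one,
  so that \<open>n = 0\<close> means the zero family.\<close>

definition poly_family :: "('e \<Rightarrow> complex) set \<Rightarrow> nat \<Rightarrow> ('e \<Rightarrow> complex poly) \<Rightarrow> bool" where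
  "poly_family R n F \<longleftrightarrow> (\<forall>i. (\<lambda>e. coeff (F e) i) \<in> R) \<and> (\<forall>e. \<forall>i\<ge>n. coeff (F e) i = 0)"

text \<open>The function-level analogue of the polynomial ring \<open>R[y]\<close>, with a degree
  bound uniform in \<open>e\<close>.\<close>

definition adjoin_var :: "('e \<Rightarrow> complex) set \<Rightarrow> ('e \<times> complex \<Rightarrow> complex) set" where
  "adjoin_var R = {\<lambda>(e, y). poly (F e) y | n F. poly_family R n F}"

context function_algebra
begin

lemma poly_family_add:
  "poly_family R n F \<Longrightarrow> poly_family R m G \<Longrightarrow> poly_family R (max n m) (\<lambda>e. F e + G e)"
  unfolding poly_family_def by (auto intro: add)

lemma poly_family_mult:
  assumes "poly_family R n F" "poly_family R m G"
  shows "poly_family R (n + m) (\<lambda>e. F e * G e)"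
proof -
  have "(\<lambda>e. coeff (F e * G e) i) \<in> R" for i
    using assms unfolding coeff_mult poly_family_def by (intro sum mult) auto
  moreover have "coeff (F e * G e) i = 0" if "i \<ge> n + m" for i e
    unfolding coeff_mult
  proof (rule sum.neutral, safe)
    fix j assume "j \<le> i"
    show "coeff (F e) j * coeff (G e) (i - j) = 0"
      using assms that \<open>j \<le> i\<close> unfolding poly_family_def by (cases "j \<ge> n") auto
  qed
  ultimately show ?thesis unfolding poly_family_def by auto
qed

lemma poly_family_const:
  assumes "a \<in> R" shows "poly_family R 1 (\<lambda>e. [:a e:])"
proof -
  have "(\<lambda>e. coeff [:a e:] i) \<in> R" for i
    using assms const by (cases i) auto
  then show ?thesis
    unfolding poly_family_def by (auto simp: coeff_pCons split: nat.splits)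
qed

lemma poly_family_power: 
  assumes "poly_family R n F" shows "\<exists>m. poly_family R m (\<lambda>e. F e ^ k)"
proof (induction k)
  case 0
  then show ?case using poly_family_const[of "\<lambda>_. 1"] const by (auto simp flip: one_pCons)
next
  case (Suc k)
  then show ?case using poly_family_mult[OF assms] by auto
qed

lemma function_algebra_adjoin_var: "function_algebra (adjoin_var R)"
proof
  show "(\<lambda>_. c) \<in> adjoin_var R" for c
    using poly_family_const[of "\<lambda>_. c"] const unfolding adjoin_var_def
    by (intro CollectI exI[of _ 1] exI[of _ "\<lambda>_. [:c:]"]) auto
next
  fix a b assume "a \<in> adjoin_var R" "b \<in> adjoin_var R"
  then obtain n F m G where *: "poly_family R n F" "poly_family R m G"
    and eq: "a = (\<lambda>(e, y). poly (F e) y)" "b = (\<lambda>(e, y). poly (G e) y)"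
    unfolding adjoin_var_def by blast
  show "(\<lambda>e. a e + b e) \<in> adjoin_var R"
    using poly_family_add[OF *] unfolding adjoin_var_def eq
    by (intro CollectI exI[of _ "max n m"] exI[of _ "\<lambda>e. F e + G e"]) auto
  show "(\<lambda>e. a e * b e) \<in> adjoin_var R"
    using poly_family_mult[OF *] unfolding adjoin_var_def eq
    by (intro CollectI exI[of _ "n + m"] exI[of _ "\<lambda>e. F e * G e"]) auto
qed

lemma lift_in_adjoin_var: "a \<in> R \<Longrightarrow> (\<lambda>x. a (fst x)) \<in> adjoin_var R"
  using poly_family_const[of a] unfolding adjoin_var_def
  by (intro CollectI exI[of _ 1] exI[of _ "\<lambda>e. [:a e:]"]) auto

lemma var_in_adjoin_var: "snd \<in> adjoin_var R"
proof -
  have "poly_family R 2 (\<lambda>e. [:0, 1:])"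
    unfolding poly_family_def by (auto simp: coeff_pCons const split: nat.splits)
  then show ?thesis
    unfolding adjoin_var_def
    by (intro CollectI exI[of _ 2] exI[of _ "\<lambda>e. [:0, 1:]"]) auto
qed

end

text \<open>One inequation per basic set is enough, since several can be multiplied
  together.\<close>

inductive constructible :: "('e \<Rightarrow> complex) set \<Rightarrow> 'e set \<Rightarrow> bool" for R where
  basic: "set as \<subseteq> R \<Longrightarrow> b \<in> R \<Longrightarrow> constructible R {e. (\<forall>a\<in>set as. a e = 0) \<and> b e \<noteq> 0}"
| union: "constructible R X \<Longrightarrow> constructible R Y \<Longrightarrow> constructible R (X \<union> Y)"

lemma adjoin_var_list:
  assumes "set as \<subseteq> adjoin_var R"
  shows "\<exists>L. (\<forall>(n, F)\<in>set L. poly_family R n F) \<and>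
    (\<forall>e y. (\<forall>a\<in>set as. a (e, y) = 0) \<longleftrightarrow> (\<forall>(n, F)\<in>set L. poly (F e) y = 0))"
  using assms
proof (induction as)
  case Nil
  then show ?case by (intro exI[of _ "[]"]) auto
next
  case (Cons a as)
  then obtain L where L: "\<forall>(n, F)\<in>set L. poly_family R n F"
    "\<forall>e y. (\<forall>a\<in>set as. a (e, y) = 0) \<longleftrightarrow> (\<forall>(n, F)\<in>set L. poly (F e) y = 0)"
    by auto
  from Cons.prems obtain n F where "poly_family R n F" "a = (\<lambda>(e, y). poly (F e) y)"
    unfolding adjoin_var_def by auto
  then show ?case
    using L by (intro exI[of _ "(n, F) # L"]) auto
qed

context function_algebra
begin

lemma constructible_empty: "constructible R {}"
  using basic[of "[]" R "\<lambda>_. 0"] const by auto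

lemma constructible_nonzero: "b \<in> R \<Longrightarrow> constructible R {e. b e \<noteq> 0}"
  using basic[of "[]" R b] by auto

lemma constructible_zero: "a \<in> R \<Longrightarrow> constructible R {e. a e = 0}"
  using basic[of "[a]" R "\<lambda>_. 1"] const by auto

lemma constructible_UN:
  "finite I \<Longrightarrow> (\<And>i. i \<in> I \<Longrightarrow> constructible R (X i)) \<Longrightarrow> constructible R (\<Union>i\<in>I. X i)"
  by (induction I rule: finite_induct) (auto intro: constructible_empty union)

lemma constructible_Int:
  assumes "constructible R X" "constructible R Y"
  shows "constructible R (X \<inter> Y)"
  using assms(1)
proof (induction rule: constructible.induct)
  case (basic as b)
  note as = basic
  show ?case using assms(2)
  proof (induction rule: constructible.induct)
    case (basic as' b')
    then have "constructible R {e. (\<forall>a\<in>set (as @ as'). a e = 0) \<and> b e * b' e \<noteq> 0}"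
      using as by (intro constructible.basic mult) auto
    then show ?case
      by (rule back_subst[of "constructible R"]) auto
  next
    case (union X Y)
    then show ?case by (simp add: Int_Un_distrib constructible.union)
  qed
next
  case (union X Y)
  then show ?case by (simp add: Int_Un_distrib2 constructible.union)
qed

lemma constructible_poly_family_nonzero:
  assumes "poly_family R n F" shows "constructible R {e. F e \<noteq> 0}"
proof -
  have "{e. F e \<noteq> 0} = (\<Union>i<n. {e. coeff (F e) i \<noteq> 0})"
  proof (safe, rule ccontr)
    fix e assume "F e \<noteq> 0" "e \<notin> (\<Union>i<n. {e. coeff (F e) i \<noteq> 0})"
    then have "coeff (F e) i = 0" for i
      using assms unfolding poly_family_def by (cases "i < n") auto
    with \<open>F e \<noteq> 0\<close> show False by (simp add: poly_eq_iff)
  qed auto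
  moreover have "constructible R {e. coeff (F e) i \<noteq> 0}" for i
    using assms constructible_nonzero unfolding poly_family_def by auto
  ultimately show ?thesis by (simp add: constructible_UN)
qed

text \<open>One step of pseudo-division: cross-multiplying by the formal leading coefficients
  cancels the top term without dividing by a function of \<open>e\<close>. The strict bounds
  \<open>Suc n\<close> and \<open>Suc m\<close> stand for formal degrees \<open>n\<close> and
  \<open>m\<close>.\<close>

lemma poly_family_reduce:
  assumes F: "poly_family R (Suc n) F" and G: "poly_family R (Suc m) G" and "m \<le> n"
  shows "poly_family R n
    (\<lambda>e. smult (coeff (G e) m) (F e) - monom (coeff (F e) n) (n - m) * G e)"
proof -
  have co: "coeff (monom (coeff (F e) n) (n - m) * G e) i =
      (if i < n - m then 0 else coeff (F e) n * coeff (G e) (i - (n - m)))" for e i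
    by (simp add: coeff_monom_mult)
  have "(\<lambda>e. coeff (smult (coeff (G e) m) (F e) - monom (coeff (F e) n) (n - m) * G e) i) \<in> R" for i
    using F G unfolding poly_family_def coeff_diff co
    by (cases "i < n - m") (auto intro!: diff mult const)
  moreover have "coeff (smult (coeff (G e) m) (F e) - monom (coeff (F e) n) (n - m) * G e) i = 0"
    if "i \<ge> n" for e i
    using F G that \<open>m \<le> n\<close> unfolding poly_family_def coeff_diff co
    by (cases "i = n") (auto simp: Suc_le_eq)
  ultimately show ?thesis unfolding poly_family_def by auto
qed

text \<open>Repeated reduction. A nonzero leading coefficient of \<open>P e\<close> is a unit of the
  complex numbers, so neither scaling by it nor subtracting multiples of \<open>P e\<close> affects
  divisibility by \<open>P e\<close>.\<close>

lemma poly_family_remainder: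
  assumes P: "poly_family R (Suc m) P" and "poly_family R N Q"
  shows "\<exists>r. poly_family R m r \<and> (\<forall>e. coeff (P e) m \<noteq> 0 \<longrightarrow> (P e dvd Q e \<longleftrightarrow> P e dvd r e))"
  using assms(2)
proof (induction N arbitrary: Q)
  case 0
  then have "poly_family R m Q" unfolding poly_family_def by auto
  then show ?case by auto
next
  case (Suc n)
  show ?case
  proof (cases "m \<le> n")
    case True
    let ?Q = "\<lambda>e. smult (coeff (P e) m) (Q e) - monom (coeff (Q e) n) (n - m) * P e"
    obtain r where r: "poly_family R m r"
      "\<And>e. coeff (P e) m \<noteq> 0 \<Longrightarrow> P e dvd ?Q e \<longleftrightarrow> P e dvd r e"
      using Suc.IH[OF poly_family_reduce[OF Suc.prems P True]] by auto
    have "P e dvd ?Q e \<longleftrightarrow> P e dvd Q e" if "coeff (P e) m \<noteq> 0" for e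
    proof -
      have "P e dvd ?Q e \<longleftrightarrow> P e dvd smult (coeff (P e) m) (Q e)"
        by (rule dvd_diff_left_iff) simp
      then show ?thesis using that by (simp add: dvd_smult_iff)
    qed
    with r show ?thesis by metis
  next
    case False
    then have "poly_family R m Q" using Suc.prems unfolding poly_family_def by auto
    then show ?thesis by auto
  qed
qed

definition common_zero_proj ::
    "(nat \<times> ('e \<Rightarrow> complex poly)) list \<Rightarrow> ('e \<Rightarrow> complex poly) \<Rightarrow> 'e set" where
  "common_zero_proj L Q =
    {e. \<exists>y. (\<forall>(n, F)\<in>set L. poly (F e) y = 0) \<and> poly (Q e) y \<noteq> 0}"

lemma constructible_case_split:
  assumes "a \<in> R" "constructible R A" "constructible R B"
    and "\<And>e. a e = 0 \<Longrightarrow> e \<in> X \<longleftrightarrow> e \<in> A" "\<And>e. a e \<noteq> 0 \<Longrightarrow> e \<in> X \<longleftrightarrow> e \<in> B"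
  shows "constructible R X"
proof -
  have "X = ({e. a e = 0} \<inter> A) \<union> ({e. a e \<noteq> 0} \<inter> B)"
    using assms(4,5) by blast
  then show ?thesis
    using assms(1-3) by (simp add: union constructible_Int constructible_zero constructible_nonzero)
qed

text \<open>A Euclidean algorithm carried out uniformly in \<open>e\<close>, branching on whether a
  formal leading coefficient vanishes. Where it does, the bound drops; where it does not, the family
  with the larger bound is reduced modulo the other, until at most one equation is left.\<close>

lemma constructible_common_zero_proj:
  assumes "\<forall>(n, F)\<in>set L. poly_family R n F" and Q: "poly_family R N Q"
  shows "constructible R (common_zero_proj L Q)"
  using assms(1)
\<comment> \<open>Each bound is counted with \<open>Suc\<close>, so that discarding a family with
  bound 0, which is identically zero, also decreases the measure.\<close>
proof (induction "sum_list (map (Suc \<circ> fst) L)" arbitrary: L rule: less_induct)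
  case less
  have IH: "constructible R (common_zero_proj L' Q)"
    if "sum_list (map (Suc \<circ> fst) L') < sum_list (map (Suc \<circ> fst) L)"
      "\<forall>(n, F)\<in>set L'. poly_family R n F" for L'
    using less.hyps that by blast
  \<comment> \<open>Where the formal leading coefficient vanishes, deleting the leading monomial
    changes no value and lowers the bound by one.\<close>
  have trim: "\<exists>A. constructible R A \<and>
      (\<forall>e. coeff (G e) m = 0 \<longrightarrow> e \<in> common_zero_proj L Q \<longleftrightarrow> e \<in> A)"
    if "set L = insert (Suc m, G) (set L')"
      "sum_list (map (Suc \<circ> fst) L) = Suc (Suc m) + sum_list (map (Suc \<circ> fst) L')" for m G L'
  proof -
    let ?G = "\<lambda>e. G e - monom (coeff (G e) m) m"
    have G: "poly_family R (Suc m) G" using less.prems that by auto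
    have "poly_family R m ?G"
      unfolding poly_family_def
    proof (intro conjI allI impI)
      show "(\<lambda>e. coeff (?G e) i) \<in> R" for i
        using G unfolding poly_family_def by (cases "i = m") (auto simp: const)
      show "coeff (?G e) i = 0" if "m \<le> i" for e i
        using G that unfolding poly_family_def by (cases "i = m") auto
    qed
    then have "constructible R (common_zero_proj ((m, ?G) # L') Q)"
      using that less.prems by (intro IH) auto
    moreover have "e \<in> common_zero_proj L Q \<longleftrightarrow> e \<in> common_zero_proj ((m, ?G) # L') Q"
      if "coeff (G e) m = 0" for e
      using that \<open>set L = _\<close> unfolding common_zero_proj_def by auto
    ultimately show ?thesis by blast
  qed
  have step: "constructible R (common_zero_proj L Q)"
    if L: "set L = {(n, F), (m, G)} \<union> set L'"
      "sum_list (map (Suc \<circ> fst) L) = Suc n + Suc m + sum_list (map (Suc \<circ> fst) L')"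
      and "m \<le> n" for n F m G L'
  proof (cases m)
    case 0
    have "poly_family R 0 G" using less.prems L 0 by auto
    then have "G e = 0" for e unfolding poly_family_def by (simp add: poly_eq_iff)
    then have "common_zero_proj L Q = common_zero_proj ((n, F) # L') Q"
      using L unfolding common_zero_proj_def by auto
    moreover have "constructible R (common_zero_proj ((n, F) # L') Q)"
      using L less.prems by (intro IH) auto
    ultimately show ?thesis by simp
  next
    case (Suc m')
    then obtain n' where n': "n = Suc n'" "m' \<le> n'" using \<open>m \<le> n\<close> by (cases n) auto
    have F: "poly_family R (Suc n') F" and G: "poly_family R (Suc m') G"
      using less.prems L n' Suc by auto
    let ?F = "\<lambda>e. smult (coeff (G e) m') (F e) - monom (coeff (F e) n') (n' - m') * G e"
    have "\<exists>A. constructible R A \<and>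
        (\<forall>e. coeff (G e) m' = 0 \<longrightarrow> e \<in> common_zero_proj L Q \<longleftrightarrow> e \<in> A)"
      using L Suc by (intro trim[of m' G "(n, F) # L'"]) auto
    then obtain A where A: "constructible R A"
      "\<And>e. coeff (G e) m' = 0 \<Longrightarrow> e \<in> common_zero_proj L Q \<longleftrightarrow> e \<in> A"
      by blast
    have B1: "constructible R (common_zero_proj ((n', ?F) # (m, G) # L') Q)"
      using L less.prems n' poly_family_reduce[OF F G n'(2)] by (intro IH) auto
    have B2: "e \<in> common_zero_proj L Q \<longleftrightarrow> e \<in> common_zero_proj ((n', ?F) # (m, G) # L') Q"
      if "coeff (G e) m' \<noteq> 0" for e
    proof -
      have "poly (?F e) y = 0 \<and> poly (G e) y = 0 \<longleftrightarrow> poly (F e) y = 0 \<and> poly (G e) y = 0" for y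
        using that by auto
      then show ?thesis using L unfolding common_zero_proj_def by auto
    qed
    have "(\<lambda>e. coeff (G e) m') \<in> R" using G unfolding poly_family_def by blast
    then show ?thesis
      using A(1) B1 A(2) B2 by (rule constructible_case_split)
  qed
  consider "L = []" | k P where "L = [(k, P)]" | n F m G L' where "L = (n, F) # (m, G) # L'"
    by (metis list.exhaust surj_pair)
  then show ?case
  proof cases
    case 1
    then have "common_zero_proj L Q = {e. Q e \<noteq> 0}"
      unfolding common_zero_proj_def by (auto simp: poly_all_0_iff_0[symmetric])
    then show ?thesis using constructible_poly_family_nonzero[OF Q] by simp
  next
    case 2
    show ?thesis
    proof (cases k)
      case 0
      then have "P e = 0" for e
        using less.prems 2 unfolding poly_family_def by (simp add: poly_eq_iff)
      then have "common_zero_proj L Q = common_zero_proj [] Q"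
        using 2 unfolding common_zero_proj_def by auto
      moreover have "constructible R (common_zero_proj [] Q)" using 2 by (intro IH) auto
      ultimately show ?thesis by simp
    next
      case (Suc m)
      then have P: "poly_family R (Suc m) P" using less.prems 2 by auto
      have "\<exists>A. constructible R A \<and>
          (\<forall>e. coeff (P e) m = 0 \<longrightarrow> e \<in> common_zero_proj L Q \<longleftrightarrow> e \<in> A)"
        using 2 Suc by (intro trim[of m P "[]"]) auto
      then obtain A where A: "constructible R A"
        "\<And>e. coeff (P e) m = 0 \<Longrightarrow> e \<in> common_zero_proj L Q \<longleftrightarrow> e \<in> A"
        by blast
      \<comment> \<open>If the leading coefficient is nonzero, \<open>P e\<close> has degree
        \<open>m\<close> and its roots have multiplicity at most \<open>m\<close>. So all of them
        are roots of \<open>Q e\<close> exactly when \<open>P e\<close> divides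
        \<open>Q e ^ m\<close>, and a remainder of degree below \<open>m\<close> decides this by
        being zero.\<close>
      obtain M where M: "poly_family R M (\<lambda>e. Q e ^ m)"
        using poly_family_power[OF Q] by blast
      obtain r where r: "poly_family R m r"
        "\<And>e. coeff (P e) m \<noteq> 0 \<Longrightarrow> P e dvd Q e ^ m \<longleftrightarrow> P e dvd r e"
        using poly_family_remainder[OF P M] by blast
      have B: "e \<in> common_zero_proj L Q \<longleftrightarrow> e \<in> {e. r e \<noteq> 0}" if lc: "coeff (P e) m \<noteq> 0" for e
      proof -
        have deg: "degree (P e) = m"
          using P lc unfolding poly_family_def
          by (intro le_antisym degree_le le_degree) (auto simp: Suc_le_eq)
        have "e \<in> common_zero_proj L Q \<longleftrightarrow> \<not> (\<forall>y. poly (P e) y = 0 \<longrightarrow> poly (Q e) y = 0)"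
          using 2 unfolding common_zero_proj_def by auto
        also have "\<dots> \<longleftrightarrow> \<not> P e dvd Q e ^ m"
          using nullstellensatz_univariate[of "P e" "Q e"] lc deg by auto
        also have "\<dots> \<longleftrightarrow> \<not> P e dvd r e" using r(2)[OF lc] by simp
        also have "P e dvd r e \<longleftrightarrow> r e = 0"
        proof
          assume dvd: "P e dvd r e"
          show "r e = 0"
          proof (rule ccontr)
            assume "r e \<noteq> 0"
            then have "m \<le> degree (r e)" using dvd_imp_degree_le[OF dvd] deg by simp
            then have "lead_coeff (r e) = 0" using r(1) unfolding poly_family_def by blast
            then show False using \<open>r e \<noteq> 0\<close> by simp
          qed
        qed simp
        finally show ?thesis by simp
      qed
      have "(\<lambda>e. coeff (P e) m) \<in> R" using P unfolding poly_family_def by blast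
      then show ?thesis
        using A(1) constructible_poly_family_nonzero[OF r(1)] A(2) B
        by (rule constructible_case_split)
    qed
  next
    case 3
    then show ?thesis
      using step[of n F m G L'] step[of m G n F L'] by (cases "m \<le> n") (auto simp: insert_commute)
  qed
qed

text \<open>Quantifier elimination for one variable: projection commutes with unions, and on a basic
  set the defining functions are polynomials in \<open>y\<close> with coefficients in
  \<open>R\<close>.\<close>

theorem constructible_projection:
  assumes "constructible (adjoin_var R) X"
  shows "constructible R {e. \<exists>y. (e, y) \<in> X}"
  using assms
proof (induction rule: constructible.induct)
  case (basic as b)
  from basic(2) obtain N Q where Q: "poly_family R N Q" "b = (\<lambda>(e, y). poly (Q e) y)"
    unfolding adjoin_var_def by auto
  obtain L where L: "\<forall>(n, F)\<in>set L. poly_family R n F"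
    "\<And>e y. (\<forall>a\<in>set as. a (e, y) = 0) \<longleftrightarrow> (\<forall>(n, F)\<in>set L. poly (F e) y = 0)"
    using adjoin_var_list[OF basic(1)] by blast
  show ?case
    using constructible_common_zero_proj[OF L(1) Q(1)] L(2) Q(2)
    unfolding common_zero_proj_def by simp
next
  case (union X Y)
  have "{e. \<exists>y. (e, y) \<in> X \<union> Y} = {e. \<exists>y. (e, y) \<in> X} \<union> {e. \<exists>y. (e, y) \<in> Y}" by auto
  then show ?case using union by (simp add: constructible.union)
qed

end

section \<open>Elimination ideals, Nullstellensatz and specialisation\<close>

definition ring_morphism :: "('a::comm_ring_1 \<Rightarrow> 'b::comm_ring_1) \<Rightarrow> bool" where
  "ring_morphism h \<longleftrightarrow> h 1 = 1 \<and> (\<forall>x y. h (x + y) = h x + h y) \<and> (\<forall>x y. h (x * y) = h x * h y)"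

lemma ring_morphismD:
  assumes "ring_morphism h"
  shows "h 1 = 1" "h (x + y) = h x + h y" "h (x * y) = h x * h y"
  using assms by (auto simp: ring_morphism_def)

lemma ring_morphism_0:
  assumes "ring_morphism h" shows "h 0 = 0"
  using ring_morphismD(2)[OF assms, of 0 0] by simp

lemma ring_morphism_sum: "ring_morphism h \<Longrightarrow> h (\<Sum>i\<in>I. a i) = (\<Sum>i\<in>I. h (a i))"
  by (induction I rule: infinite_finite_induct) (auto simp: ring_morphism_0 ring_morphismD)

lemma ring_morphism_power: "ring_morphism h \<Longrightarrow> h (a ^ n) = h a ^ n"
  by (induction n) (auto simp: ring_morphismD)

lemma ring_morphism_dvd: "ring_morphism h \<Longrightarrow> a dvd b \<Longrightarrow> h a dvd h b"
  by (auto simp: dvd_def ring_morphismD)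

lemma ring_morphism_map_poly:
  assumes "ring_morphism h" shows "ring_morphism (map_poly h)"
  unfolding ring_morphism_def
proof (intro conjI allI)
  note h = ring_morphismD[OF assms] ring_morphism_0[OF assms] ring_morphism_sum[OF assms]
  show "map_poly h 1 = 1" by (simp add: h)
  show "map_poly h (x + y) = map_poly h x + map_poly h y" for x y
    by (rule poly_eqI) (simp add: coeff_map_poly h)
  show "map_poly h (x * y) = map_poly h x * map_poly h y" for x y
    by (rule poly_eqI) (simp add: coeff_map_poly coeff_mult h)
qed

lemma ring_morphism_poly: "ring_morphism (\<lambda>p. poly p c)"
  by (simp add: ring_morphism_def)

lemma ring_morphism_comp:
  "ring_morphism g \<Longrightarrow> ring_morphism h \<Longrightarrow> ring_morphism (\<lambda>x. g (h x))"
  by (simp add: ring_morphism_def)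

lemma ring_morphism_eval_poly:
  assumes "ring_morphism h" shows "h (poly p x) = poly (map_poly h p) (h x)"
  by (induction p) (simp_all add: map_poly_pCons ring_morphismD[OF assms] ring_morphism_0[OF assms])

text \<open>Coprimality in the sense of factorisation, weaker than generating the unit ideal: two
  distinct variables satisfy it. Over a field it holds for every set, as there are no irreducible
  elements.\<close>

definition no_common_irreducible :: "'a::comm_semiring_1 set \<Rightarrow> bool" where
  "no_common_irreducible F \<longleftrightarrow> (\<nexists>p. irreducible p \<and> (\<forall>f\<in>F. p dvd f))"

lemma degree_prod_mset_0:
  "(\<And>p. p \<in># M \<Longrightarrow> degree p = 0) \<Longrightarrow> degree (prod_mset M) = 0"
proof (induction M)
  case (add p M)
  then show ?case using degree_mult_le[of p "prod_mset M"] by simp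
qed simp

text \<open>\<open>m\<close> is associated to the product of its prime factors, which would have
  degree 0 if all of them had.\<close>

lemma irreducible_factor_positive_degree:
  fixes m :: "'a::{factorial_ring_gcd,semiring_gcd_mult_normalize} poly"
  assumes "degree m > 0"
  obtains p where "irreducible p" "p dvd m" "degree p > 0"
proof (rule ccontr)
  assume no: "\<not> thesis"
  let ?N = "prod_mset (prime_factorization m)"
  have "m \<noteq> 0" using assms by auto
  have "degree ?N = 0"
  proof (rule degree_prod_mset_0)
    fix p assume "p \<in># prime_factorization m"
    then have "irreducible p" "p dvd m"
      by (auto simp: in_prime_factors_iff prime_elem_imp_irreducible)
    then show "degree p = 0" using no that by blast
  qed
  moreover have "normalize ?N = normalize m"
    using \<open>m \<noteq> 0\<close> by (rule prod_mset_prime_factorization_weak)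
  then have "m dvd ?N" "?N \<noteq> 0" using \<open>m \<noteq> 0\<close> by (auto dest: associatedD2)
  then have "degree m \<le> degree ?N" by (rule dvd_imp_degree_le)
  ultimately show False using assms by simp
qed

text \<open>A nonzero element of minimal degree in the ideal pseudo-divides every generator, so if it had
  positive degree one of its irreducible factors would be common to all generators.\<close>

lemma elimination_ideal_nonzero:
  fixes F :: "'a::{factorial_ring_gcd,semiring_gcd_mult_normalize} poly set"
  assumes "finite F" and F: "no_common_irreducible F"
  obtains r c where "r \<noteq> 0" "[:r:] = (\<Sum>f\<in>F. c f * f)"
proof -
  define I where "I = {\<Sum>f\<in>F. c f * f | c. True}"
  have I_gen: "f \<in> I" if "f \<in> F" for f
  proof -
    have "(\<Sum>g\<in>F. (if g = f then 1 else 0) * g) = f"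
      using assms(1) that by (simp add: if_distrib[of "\<lambda>x. x * _"] sum.delta cong: if_cong)
    then show ?thesis unfolding I_def by (auto intro: exI[of _ "\<lambda>g. if g = f then 1 else 0"] dest: sym)
  qed
  have I_mult: "h * g \<in> I" if "g \<in> I" for g h
  proof -
    from that obtain c where "g = (\<Sum>f\<in>F. c f * f)" unfolding I_def by auto
    then have "h * g = (\<Sum>f\<in>F. (h * c f) * f)" by (simp add: sum_distrib_left mult.assoc)
    then show ?thesis unfolding I_def by (auto intro: exI[of _ "\<lambda>f. h * c f"])
  qed
  have I_diff: "g - h \<in> I" if gh: "g \<in> I" "h \<in> I" for g h
  proof -
    from gh obtain c c' where "g = (\<Sum>f\<in>F. c f * f)" "h = (\<Sum>f\<in>F. c' f * f)"
      unfolding I_def by auto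
    then have "g - h = (\<Sum>f\<in>F. (c f - c' f) * f)" by (simp add: sum_subtractf left_diff_distrib)
    then show ?thesis unfolding I_def by (auto intro: exI[of _ "\<lambda>f. c f - c' f"])
  qed
  \<comment> \<open>If all generators were 0, any irreducible polynomial would divide them all; one
    exists because \<open>[:0, 1:]\<close> has positive degree.\<close>
  have "\<exists>f\<in>F. f \<noteq> 0"
  proof (rule ccontr)
    assume "\<not> ?thesis"
    moreover obtain p where "irreducible (p :: 'a poly)"
      using irreducible_factor_positive_degree[of "[:0, 1:] :: 'a poly"] by auto
    ultimately show False using F unfolding no_common_irreducible_def by force
  qed
  then have "\<exists>g. g \<in> I \<and> g \<noteq> 0" using I_gen by blast
  then obtain m where m: "m \<in> I" "m \<noteq> 0" and
    min: "\<And>g. g \<in> I \<Longrightarrow> g \<noteq> 0 \<Longrightarrow> degree m \<le> degree g"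
    using ex_has_least_nat[of "\<lambda>g. g \<in> I \<and> g \<noteq> 0" _ degree] by blast
  have "degree m = 0"
  proof (rule ccontr)
    assume "degree m \<noteq> 0"
    then obtain p where p: "irreducible p" "p dvd m" "degree p > 0"
      using irreducible_factor_positive_degree[of m] by auto
    have "p dvd f" if "f \<in> F" for f
    proof -
      \<comment> \<open>The coefficient ring need not be a field, hence pseudo-division. The extra
        scalar \<open>a\<close> is nonzero, so \<open>p\<close>, having positive degree, cannot
        divide it.\<close>
      obtain a q where aq: "a \<noteq> 0" "smult a f = m * q + pseudo_mod f m"
        using pseudo_mod(1)[OF m(2)] by blast
      have "pseudo_mod f m = [:a:] * f - q * m" using aq(2) by (simp add: algebra_simps)
      then have "pseudo_mod f m \<in> I" using I_diff I_mult I_gen[OF that] m(1) by metis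
      then have "pseudo_mod f m = 0"
        using min pseudo_mod(2)[OF m(2), of f] by (meson not_le)
      then have "[:a:] * f = m * q" using aq(2) by simp
      then have "p dvd [:a:] * f" using p(2) by simp
      then have "p dvd [:a:] \<or> p dvd f"
        using p(1) by (simp only: prime_elem_dvd_mult_iff[OF irreducible_imp_prime_elem])
      moreover have "\<not> p dvd [:a:]"
        using dvd_imp_degree_le[of p "[:a:]"] p(3) aq(1) by auto
      ultimately show ?thesis by blast
    qed
    then show False using F p(1) unfolding no_common_irreducible_def by blast
  qed
  then obtain r where "m = [:r:]" by (rule degree_eq_zeroE)
  with m that show thesis unfolding I_def by auto
qed

section \<open>Nullstellensatz for hypersurfaces, by induction on the number of variables\<close>

definition ext_eval :: "('e \<Rightarrow> 'a::comm_ring_1 \<Rightarrow> complex) \<Rightarrow> 'e \<times> complex \<Rightarrow> 'a poly \<Rightarrow> complex" where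
  "ext_eval ev = (\<lambda>(e, c) p. poly (map_poly (ev e) p) c)"

text \<open>The last conjunct is the Nullstellensatz for an irreducible \<open>p\<close>, in
  contrapositive form. The middle one, faithfulness of evaluation, supplies points off a given
  hypersurface in the induction.\<close>

definition hypersurface_nullstellensatz :: "('e \<Rightarrow> 'a::idom \<Rightarrow> complex) \<Rightarrow> bool" where
  "hypersurface_nullstellensatz ev \<longleftrightarrow>
    (\<forall>e. ring_morphism (ev e)) \<and> (\<forall>q. q \<noteq> 0 \<longrightarrow> (\<exists>e. ev e q \<noteq> 0)) \<and>
    (\<forall>p q. irreducible p \<longrightarrow> \<not> p dvd q \<longrightarrow> (\<exists>e. ev e p = 0 \<and> ev e q \<noteq> 0))"

lemma hypersurface_nullstellensatzD:
  assumes "hypersurface_nullstellensatz ev"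
  shows "ring_morphism (ev e)" "q \<noteq> 0 \<Longrightarrow> \<exists>e. ev e q \<noteq> 0"
    "irreducible p \<Longrightarrow> \<not> p dvd q \<Longrightarrow> \<exists>e. ev e p = 0 \<and> ev e q \<noteq> 0"
  using assms unfolding hypersurface_nullstellensatz_def by auto

lemma ring_morphism_ext_eval:
  "ring_morphism (ev e) \<Longrightarrow> ring_morphism (ext_eval ev (e, c))"
  unfolding ext_eval_def prod.case
  by (rule ring_morphism_comp[OF ring_morphism_poly ring_morphism_map_poly])

lemma ext_eval_const: "ring_morphism (ev e) \<Longrightarrow> ext_eval ev (e, c) [:a:] = ev e a"
  by (simp add: ext_eval_def map_poly_pCons ring_morphism_0)

lemma no_common_irreducible_pair:
  fixes p q :: "'a::algebraic_semidom"
  assumes "irreducible p" "\<not> p dvd q"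
  shows "no_common_irreducible {p, q}"
  unfolding no_common_irreducible_def
proof (safe)
  fix p' assume "irreducible p'" "\<forall>f\<in>{p, q}. p' dvd f"
  then have "p' dvd p" "p' dvd q" "\<not> p' dvd 1" by (auto simp: irreducible_not_unit)
  then have "p dvd p'" using irreducibleD'[OF assms(1)] by blast
  then show False using \<open>p' dvd q\<close> assms(2) dvd_trans by blast
qed

text \<open>If \<open>p\<close> involves the new variable, elimination produces a nonzero
  \<open>r\<close> free of it in the ideal of \<open>p\<close> and \<open>q\<close>. Over a point
  where neither \<open>r\<close> nor the leading coefficient of \<open>p\<close> vanishes,
  \<open>p\<close> still has a root in the new variable, and there \<open>q\<close> cannot
  vanish.\<close>

lemma hypersurface_nullstellensatz_ext:
  fixes ev :: "'e \<Rightarrow> 'a::{factorial_ring_gcd,semiring_gcd_mult_normalize} \<Rightarrow> complex"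
  assumes "hypersurface_nullstellensatz ev"
  shows "hypersurface_nullstellensatz (ext_eval ev)"
proof -
  have hom: "\<And>e. ring_morphism (ev e)"
    and sep: "\<And>q. q \<noteq> 0 \<Longrightarrow> \<exists>e. ev e q \<noteq> 0"
    and null: "\<And>p q. irreducible p \<Longrightarrow> \<not> p dvd q \<Longrightarrow> \<exists>e. ev e p = 0 \<and> ev e q \<noteq> 0"
    using hypersurface_nullstellensatzD[OF assms] by blast+
  have nz: "\<exists>c. ext_eval ev (e, c) q \<noteq> 0" if "ev e (coeff q n) \<noteq> 0" for e q n
  proof -
    have "coeff (map_poly (ev e) q) n \<noteq> 0"
      using that by (simp add: coeff_map_poly ring_morphism_0[OF hom])
    then have "map_poly (ev e) q \<noteq> 0" by auto
    then show ?thesis unfolding ext_eval_def by (auto simp: poly_all_0_iff_0[symmetric])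
  qed
  have "\<exists>e. ext_eval ev e q \<noteq> 0" if "q \<noteq> 0" for q
    using sep[of "lead_coeff q"] nz that by (metis leading_coeff_0_iff)
  moreover have "\<exists>e. ext_eval ev e p = 0 \<and> ext_eval ev e q \<noteq> 0"
    if p: "irreducible p" and pq: "\<not> p dvd q" for p q
  \<comment> \<open>A \<open>p\<close> without the new variable divides \<open>q\<close> exactly
    when it divides every coefficient, so the hypothesis on the coefficient ring applies to one of
    these.\<close>
  proof (cases "degree p = 0")
    case True
    then obtain a where a: "p = [:a:]" by (rule degree_eq_zeroE)
    obtain n where "\<not> a dvd coeff q n"
      using pq unfolding a const_poly_dvd_iff by blast
    moreover have "irreducible a" using p unfolding a irreducible_const_poly_iff .
    ultimately obtain e where e: "ev e a = 0" "ev e (coeff q n) \<noteq> 0" using null by blast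
    then show ?thesis
      using nz[OF e(2)] ext_eval_const[of ev e, OF hom] unfolding a by metis
  next
    case False
    obtain r c where r: "r \<noteq> 0" "[:r:] = (\<Sum>f\<in>{p, q}. c f * f)"
      using elimination_ideal_nonzero[of "{p, q}"] no_common_irreducible_pair[OF p pq] by auto
    have "r * lead_coeff p \<noteq> 0" using r(1) False by auto
    then obtain e where e: "ev e (r * lead_coeff p) \<noteq> 0" using sep by blast
    then have e_r: "ev e r \<noteq> 0" and e_p: "ev e (lead_coeff p) \<noteq> 0"
      by (auto simp: ring_morphismD[OF hom])
    have "degree (map_poly (ev e) p) = degree p"
      using e_p by (rule map_poly_degree_eq)
    then have "\<not> constant (poly (map_poly (ev e) p))" using False by (simp add: constant_degree)
    then obtain y where y: "ext_eval ev (e, y) p = 0"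
      unfolding ext_eval_def using fundamental_theorem_of_algebra by auto
    have "ext_eval ev (e, y) q \<noteq> 0"
    proof
      assume q: "ext_eval ev (e, y) q = 0"
      note h = ring_morphism_ext_eval[of ev e y, OF hom]
      have "ev e r = ext_eval ev (e, y) [:r:]" using ext_eval_const[of ev e, OF hom] by simp
      also have "\<dots> = (\<Sum>f\<in>{p, q}. ext_eval ev (e, y) (c f) * ext_eval ev (e, y) f)"
        unfolding r(2) ring_morphism_sum[OF h] ring_morphismD(3)[OF h] ..
      also have "\<dots> = 0" using y q by (intro sum.neutral) auto
      finally show False using e_r by simp
    qed
    with y show ?thesis by blast
  qed
  ultimately show ?thesis
    unfolding hypersurface_nullstellensatz_def
    using ring_morphism_ext_eval[of ev, OF hom] by auto
qed

text \<open>In zero variables there is one point, and the condition on irreducible elements is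
  vacuous in a field.\<close>

lemma hypersurface_nullstellensatz_constants:
  "hypersurface_nullstellensatz (\<lambda>_::unit. \<lambda>p. p)"
  unfolding hypersurface_nullstellensatz_def
  by (auto simp: ring_morphism_def irreducible_def dvd_field_iff)

section \<open>Specialisation of a parameter and persistence of coprimality\<close>

definition generic_specialisation ::
    "(complex \<Rightarrow> 'b::idom \<Rightarrow> 'a::idom) \<Rightarrow> bool" where
  "generic_specialisation \<sigma> \<longleftrightarrow> (\<forall>t. ring_morphism (\<sigma> t)) \<and>
    (\<forall>b. b \<noteq> 0 \<longrightarrow> (\<forall>\<^sub>F t in cofinite. \<sigma> t b \<noteq> 0)) \<and>
    (\<forall>F. finite F \<longrightarrow> no_common_irreducible F \<longrightarrow>
      (\<forall>\<^sub>F t in cofinite. no_common_irreducible (\<sigma> t ` F)))"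

lemma generic_specialisationD:
  assumes "generic_specialisation \<sigma>"
  shows "ring_morphism (\<sigma> t)" "b \<noteq> 0 \<Longrightarrow> \<forall>\<^sub>F t in cofinite. \<sigma> t b \<noteq> 0"
    "finite F \<Longrightarrow> no_common_irreducible F \<Longrightarrow>
      \<forall>\<^sub>F t in cofinite. no_common_irreducible (\<sigma> t ` F)"
  using assms unfolding generic_specialisation_def by auto

lemma generic_specialisation_poly:
  "generic_specialisation (\<lambda>t p. poly p t :: complex)"
proof -
  have "\<forall>\<^sub>F t in cofinite. poly b t \<noteq> 0" if "b \<noteq> 0" for b :: "complex poly"
    using poly_roots_finite[OF that] by (simp add: eventually_cofinite)
  moreover have "no_common_irreducible F" for F :: "complex set"
    unfolding no_common_irreducible_def by (auto simp: irreducible_def dvd_field_iff)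
  ultimately show ?thesis
    unfolding generic_specialisation_def using ring_morphism_poly by auto
qed

text \<open>For coprimality, elimination gives a nonzero \<open>r\<close>, free of the outermost
  variable, in the ideal of \<open>F\<close>. Where \<open>r\<close> survives, a common irreducible
  factor of the specialised family divides it, hence has degree 0 and divides all specialised
  coefficients, which the hypothesis on \<sigma> excludes for almost all \<open>t\<close>.\<close>

lemma generic_specialisation_map_poly:
  fixes \<sigma> :: "complex \<Rightarrow> 'b::{factorial_ring_gcd,semiring_gcd_mult_normalize} \<Rightarrow> 'a::idom"
  assumes "generic_specialisation \<sigma>"
  shows "generic_specialisation (\<lambda>t. map_poly (\<sigma> t))"
proof -
  have hom: "\<And>t. ring_morphism (\<sigma> t)"
    and nz: "\<And>b. b \<noteq> 0 \<Longrightarrow> \<forall>\<^sub>F t in cofinite. \<sigma> t b \<noteq> 0"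
    and cop: "\<And>F. finite F \<Longrightarrow> no_common_irreducible F \<Longrightarrow>
      \<forall>\<^sub>F t in cofinite. no_common_irreducible (\<sigma> t ` F)"
    using generic_specialisationD[OF assms] by blast+
  note hom' = ring_morphism_map_poly[OF hom]
  have coeff_\<sigma>: "coeff (map_poly (\<sigma> t) p) n = \<sigma> t (coeff p n)" for t p n
    by (simp add: coeff_map_poly ring_morphism_0[OF hom])
  have "\<forall>\<^sub>F t in cofinite. map_poly (\<sigma> t) b \<noteq> 0" if "b \<noteq> 0" for b
  proof -
    have "\<forall>\<^sub>F t in cofinite. \<sigma> t (lead_coeff b) \<noteq> 0" using nz that by simp
    then show ?thesis by eventually_elim (metis coeff_\<sigma> coeff_0)
  qed
  moreover have "\<forall>\<^sub>F t in cofinite. no_common_irreducible (map_poly (\<sigma> t) ` F)"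
    if fin: "finite F" and F: "no_common_irreducible F" for F
  proof -
    obtain r c where r: "r \<noteq> 0" "[:r:] = (\<Sum>f\<in>F. c f * f)"
      using elimination_ideal_nonzero[OF fin F] .
    \<comment> \<open>The coefficients of all members of \<open>F\<close>. They inherit coprimality,
      since an irreducible dividing them all is, as a constant polynomial, a common irreducible
      factor of \<open>F\<close>.\<close>
    define C where "C = (\<Union>f\<in>F. set (coeffs f))"
    have dvd_C: "[:p:] dvd f" if "f \<in> F" "\<forall>a\<in>C. p dvd a" for p f
    proof -
      have "p dvd coeff f n" for n
        using that unfolding C_def
        by (cases "coeff f n = 0") (force intro: coeff_in_coeffs simp: le_degree)+
      then show ?thesis by (simp add: const_poly_dvd_iff)
    qed
    have "no_common_irreducible C"
      unfolding no_common_irreducible_def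
    proof safe
      fix p assume "irreducible p" "\<forall>a\<in>C. p dvd a"
      then have "irreducible [:p:]" "\<forall>f\<in>F. [:p:] dvd f"
        using dvd_C by (auto simp: irreducible_const_poly_iff)
      then show False using F unfolding no_common_irreducible_def by blast
    qed
    then have "\<forall>\<^sub>F t in cofinite. no_common_irreducible (\<sigma> t ` C)"
      using fin by (intro cop) (auto simp: C_def)
    moreover have "\<forall>\<^sub>F t in cofinite. \<sigma> t r \<noteq> 0" using nz r(1) .
    ultimately show ?thesis
    proof eventually_elim
      case (elim t)
      show ?case
        unfolding no_common_irreducible_def
      proof safe
        fix P assume P: "irreducible P" "\<forall>f\<in>map_poly (\<sigma> t) ` F. P dvd f"
        have "[:\<sigma> t r:] = map_poly (\<sigma> t) [:r:]"
          by (simp add: map_poly_pCons ring_morphism_0[OF hom])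
        also have "\<dots> = (\<Sum>f\<in>F. map_poly (\<sigma> t) (c f) * map_poly (\<sigma> t) f)"
          unfolding r(2) ring_morphism_sum[OF hom'] ring_morphismD(3)[OF hom'] ..
        finally have "P dvd [:\<sigma> t r:]" using P(2) by (auto intro: dvd_sum)
        then have "degree P = 0" using dvd_imp_degree_le[of P "[:\<sigma> t r:]"] elim(2) by auto
        then obtain p where p: "P = [:p:]" by (rule degree_eq_zeroE)
        have "p dvd \<sigma> t a" if "a \<in> C" for a
        proof -
          from that obtain f where f: "f \<in> F" "a \<in> set (coeffs f)" unfolding C_def by blast
          then obtain n where "a = coeff f n" by (auto simp: coeffs_def split: if_splits)
          moreover have "p dvd coeff (map_poly (\<sigma> t) f) n"
            using P(2) f(1) unfolding p const_poly_dvd_iff by blast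
          ultimately show ?thesis by (simp add: coeff_\<sigma>)
        qed
        moreover have "irreducible p" using P(1) unfolding p irreducible_const_poly_iff .
        ultimately show False using elim(1) unfolding no_common_irreducible_def by blast
      qed
    qed
  qed
  ultimately show ?thesis
    unfolding generic_specialisation_def using hom' by blast
qed

section \<open>Generic slices of the offset\<close>

lemma zero_of_prime_factor:
  fixes G :: "'a::factorial_ring_gcd" and h :: "'a \<Rightarrow> complex"
  assumes h: "ring_morphism h" and "G \<noteq> 0" "h G = 0"
  obtains p where "p \<in> prime_factors G" "h p = 0"
proof -
  have prod: "\<exists>p\<in>#M. h p = 0" if "h (prod_mset M) = 0" for M
    using that by (induction M) (auto simp: ring_morphismD[OF h])
  have "normalize (prod_mset (prime_factorization G)) = normalize G"
    using assms(2) by (rule prod_mset_prime_factorization_weak)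
  then have "G dvd prod_mset (prime_factorization G)" by (auto dest: associatedD2)
  then have "h (prod_mset (prime_factorization G)) = 0"
    using ring_morphism_dvd[OF h, of G] assms(3) by simp
  then show thesis using prod that by blast
qed

text \<open>Divisibility by \<open>p\<close> decides membership generically. For a basic set, an
  equation not divisible by \<open>p\<close> serves as \<open>b\<close> and excludes the set; if
  \<open>p\<close> divides the inequation, \<open>b = 1\<close> excludes it; otherwise all equations
  hold on the zero set of \<open>p\<close> and the inequation is \<open>b\<close>. For unions the
  two exceptional polynomials are multiplied, which uses that \<open>p\<close> is prime.\<close>

lemma constructible_generic_dichotomy:
  fixes ev :: "'e \<Rightarrow> 'a::comm_ring_1 \<Rightarrow> complex"
  assumes hom: "\<And>e. ring_morphism (ev e)" and p: "prime_elem p"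
    and "constructible (range (\<lambda>G e. ev e G)) X"
  shows "\<exists>b. \<not> p dvd b \<and> ((\<forall>e. ev e p = 0 \<and> ev e b \<noteq> 0 \<longrightarrow> e \<in> X) \<or>
    (\<forall>e. ev e p = 0 \<and> ev e b \<noteq> 0 \<longrightarrow> e \<notin> X))"
  using assms(3)
proof (induction rule: constructible.induct)
  case (basic as b)
  from basic(2) obtain B where B: "b = (\<lambda>e. ev e B)" by auto
  have dvd_zero: "ev e q = 0" if "p dvd q" "ev e p = 0" for e q
    using ring_morphism_dvd[OF hom[of e] that(1)] that(2) by simp
  consider A where "(\<lambda>e. ev e A) \<in> set as" "\<not> p dvd A" | "p dvd B"
    | "\<forall>A. (\<lambda>e. ev e A) \<in> set as \<longrightarrow> p dvd A" "\<not> p dvd B"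
    by blast
  then show ?case
  proof cases
    case 1
    then show ?thesis by (intro exI[of _ A]) force
  next
    case 2
    have "\<not> p dvd 1" using p by (simp add: prime_elem_def)
    then show ?thesis using dvd_zero[OF 2] B by (intro exI[of _ 1]) auto
  next
    case 3
    have "a e = 0" if "a \<in> set as" "ev e p = 0" for a e
      using that 3(1) basic(1) dvd_zero by blast
    then show ?thesis using 3(2) B by (intro exI[of _ B]) auto
  qed
next
  case (union X Y)
  then obtain b c where b: "\<not> p dvd b" "(\<forall>e. ev e p = 0 \<and> ev e b \<noteq> 0 \<longrightarrow> e \<in> X) \<or>
      (\<forall>e. ev e p = 0 \<and> ev e b \<noteq> 0 \<longrightarrow> e \<notin> X)"
    and c: "\<not> p dvd c" "(\<forall>e. ev e p = 0 \<and> ev e c \<noteq> 0 \<longrightarrow> e \<in> Y) \<or>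
      (\<forall>e. ev e p = 0 \<and> ev e c \<noteq> 0 \<longrightarrow> e \<notin> Y)"
    by blast
  have "\<not> p dvd b * c" using b(1) c(1) p by (simp add: prime_elem_dvd_mult_iff)
  then show ?case
    using b(2) c(2) by (intro exI[of _ "b * c"]) (auto simp: ring_morphismD[OF hom])
qed

text \<open>The zero set of \<open>G\<close> is the Zariski closure of \<open>S\<close>, so no
  component of it can be generically disjoint from \<open>S\<close>.\<close>

lemma constructible_contains_generic_part:
  fixes ev :: "'e \<Rightarrow> 'a::factorial_ring_gcd \<Rightarrow> complex"
  assumes null: "hypersurface_nullstellensatz ev"
    and S: "constructible (range (\<lambda>G e. ev e G)) S"
    and "G \<noteq> 0" and S_G: "\<And>e. e \<in> S \<Longrightarrow> ev e G = 0"
    and closure: "\<And>q e. (\<And>e. e \<in> S \<Longrightarrow> ev e q = 0) \<Longrightarrow> ev e G = 0 \<Longrightarrow> ev e q = 0"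
    and p: "p \<in> prime_factors G"
  shows "\<exists>b. \<not> p dvd b \<and> (\<forall>e. ev e p = 0 \<and> ev e b \<noteq> 0 \<longrightarrow> e \<in> S)"
proof -
  have hom: "\<And>e. ring_morphism (ev e)"
    and zeros: "\<And>p q. irreducible p \<Longrightarrow> \<not> p dvd q \<Longrightarrow> \<exists>e. ev e p = 0 \<and> ev e q \<noteq> 0"
    using hypersurface_nullstellensatzD[OF null] by blast+
  have pe: "prime_elem p" and "p dvd G" using p by (auto simp: in_prime_factors_iff)
  obtain b where b: "\<not> p dvd b" "(\<forall>e. ev e p = 0 \<and> ev e b \<noteq> 0 \<longrightarrow> e \<in> S) \<or>
      (\<forall>e. ev e p = 0 \<and> ev e b \<noteq> 0 \<longrightarrow> e \<notin> S)"
    using constructible_generic_dichotomy[OF hom pe S] by blast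
  have "\<not> (\<forall>e. ev e p = 0 \<and> ev e b \<noteq> 0 \<longrightarrow> e \<notin> S)"
  proof
    \<comment> \<open>With \<open>G = p ^ k * h\<close> and \<open>p\<close> not dividing
      \<open>h\<close>, every point of \<open>S\<close> would be a zero of \<open>b * h\<close>. By
      \<open>closure\<close> so would every zero of \<open>p\<close>, forcing \<open>p\<close> to
      divide \<open>b * h\<close>.\<close>
    assume disj: "\<forall>e. ev e p = 0 \<and> ev e b \<noteq> 0 \<longrightarrow> e \<notin> S"
    obtain h where h: "G = p ^ multiplicity p G * h" "\<not> p dvd h"
      using multiplicity_decompose'[of G p] \<open>G \<noteq> 0\<close> pe by (auto simp: prime_elem_def)
    have bh: "ev e (b * h) = 0" if "e \<in> S" for e
    proof -
      have "ev e p ^ multiplicity p G * ev e h = 0"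
        using S_G[OF that] h(1) ring_morphismD(3)[OF hom] ring_morphism_power[OF hom] by metis
      then have "ev e p = 0 \<or> ev e h = 0" by auto
      then show ?thesis using disj that by (auto simp: ring_morphismD[OF hom])
    qed
    have "ev e (b * h) = 0" if "ev e p = 0" for e
    proof (rule closure)
      show "ev e G = 0" using ring_morphism_dvd[OF hom \<open>p dvd G\<close>, of e] that by simp
    qed (rule bh)
    then have "p dvd b * h" using zeros pe prime_elem_imp_irreducible by blast
    then show False using b(1) h(2) pe by (simp add: prime_elem_dvd_mult_iff)
  qed
  with b show ?thesis by blast
qed

section \<open>Evaluation in several variables and the order of the variables\<close>

lemma eval3_iterated:
  "eval3 p a b c = poly (map_poly (\<lambda>q. poly (map_poly (\<lambda>r. poly r c) q) b) p) a"
proof -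
  \<comment> \<open>\<open>eval3\<close> substitutes for the outermost variable first,
    \<open>ext_eval\<close> for the innermost; the two orders agree because evaluation at
    \<open>c\<close> is a ring homomorphism.\<close>
  have 1: "poly (poly q [:b:]) c = poly (map_poly (\<lambda>r. poly r c) q) b" for q
    using ring_morphism_eval_poly[OF ring_morphism_poly[of c], of q "[:b:]"] by simp
  have "ring_morphism (\<lambda>q. poly (poly q [:b:]) c)"
    by (simp add: ring_morphism_def)
  from ring_morphism_eval_poly[OF this, of p "[:[:a:]:]"] show ?thesis
    unfolding eval3_def by (simp add: 1)
qed

lemma ring_morphism_eval3: "ring_morphism (\<lambda>p. eval3 p a b c)"
  by (simp add: ring_morphism_def eval3_def)

lemma ring_morphism_eval4: "ring_morphism (\<lambda>p. eval4 p a b c d)"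
  by (simp add: ring_morphism_def eval4_def eval3_def)

lemma eval4_iterated: "eval4 p a b c d = poly (map_poly (\<lambda>q. eval3 q b c d) p) a"
  using ring_morphism_eval_poly[OF ring_morphism_eval3, of p "[:[:[:a:]:]:]"]
  unfolding eval4_def by (simp add: eval3_def)

lemma hypersurface_nullstellensatz_reindex:
  assumes "hypersurface_nullstellensatz ev" "surj \<phi>"
  shows "hypersurface_nullstellensatz (\<lambda>e. ev (\<phi> e))"
  unfolding hypersurface_nullstellensatz_def
proof (intro conjI allI impI)
  show "ring_morphism (ev (\<phi> e))" for e
    using assms(1) by (rule hypersurface_nullstellensatzD)
  show "\<exists>e. ev (\<phi> e) q \<noteq> 0" if "q \<noteq> 0" for q
    using hypersurface_nullstellensatzD(2)[OF assms(1) that] assms(2) by (metis surjD)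
  show "\<exists>e. ev (\<phi> e) p = 0 \<and> ev (\<phi> e) q \<noteq> 0" if "irreducible p" "\<not> p dvd q" for p q
    using hypersurface_nullstellensatzD(3)[OF assms(1) that] assms(2) by (metis surjD)
qed

lemma nullstellensatz_eval3:
  "hypersurface_nullstellensatz
    (\<lambda>(e :: ((unit \<times> complex) \<times> complex) \<times> complex) p. eval3 p (snd e) (snd (fst e)) (snd (fst (fst e))))"
  (is "hypersurface_nullstellensatz ?ev")
proof -
  have "?ev = ext_eval (ext_eval (ext_eval (\<lambda>_ p. p)))"
    by (simp add: fun_eq_iff ext_eval_def eval3_iterated)
  then show ?thesis
    by (simp add: hypersurface_nullstellensatz_ext hypersurface_nullstellensatz_constants)
qed

lemma nullstellensatz_eval4:
  "hypersurface_nullstellensatz (\<lambda>(e :: (((unit \<times> complex) \<times> complex) \<times> complex) \<times> complex) p.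
    eval4 p (snd e) (snd (fst e)) (snd (fst (fst e))) (snd (fst (fst (fst e)))))"
  (is "hypersurface_nullstellensatz ?ev")
proof -
  have "?ev = ext_eval (\<lambda>e p. eval3 p (snd e) (snd (fst e)) (snd (fst (fst e))))"
    by (simp add: fun_eq_iff ext_eval_def eval4_iterated)
  then show ?thesis
    by (simp add: hypersurface_nullstellensatz_ext nullstellensatz_eval3)
qed

lemma irreducible_not_dvd_eval3:
  assumes "irreducible p" "\<not> p dvd q"
  shows "\<exists>a b c. eval3 p a b c = 0 \<and> eval3 q a b c \<noteq> 0"
  using hypersurface_nullstellensatzD(3)[OF nullstellensatz_eval3 assms] by blast

lemma eval4_nonzero: "p \<noteq> 0 \<Longrightarrow> \<exists>a b c d. eval4 p a b c d \<noteq> 0"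
  using hypersurface_nullstellensatzD(2)[OF nullstellensatz_eval4] by blast

context function_algebra
begin

lemma eval_poly_in:
  assumes "\<And>a. (\<lambda>e. h e a) \<in> R" "\<And>e. ring_morphism (h e)" "x \<in> R"
  shows "(\<lambda>e. poly (map_poly (h e) p) (x e)) \<in> R"
proof (induction p)
  case 0
  then show ?case by (simp add: const)
next
  case (pCons a p)
  then show ?case
    using assms(1,3) by (simp add: map_poly_pCons ring_morphism_0[OF assms(2)] add mult)
qed

lemma eval3_in:
  assumes "a \<in> R" "b \<in> R" "c \<in> R"
  shows "(\<lambda>e. eval3 p (a e) (b e) (c e)) \<in> R"
proof -
  have "(\<lambda>e. poly r (c e)) \<in> R" for r
    using eval_poly_in[of "\<lambda>_ x. x" c r] assms(3) const by (simp add: ring_morphism_def)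
  then have "(\<lambda>e. poly (map_poly (\<lambda>r. poly r (c e)) q) (b e)) \<in> R" for q
    using assms(2) by (intro eval_poly_in ring_morphism_poly)
  then show ?thesis
    unfolding eval3_iterated
    by (rule eval_poly_in[OF _ _ assms(1)])
      (rule ring_morphism_comp[OF ring_morphism_poly ring_morphism_map_poly[OF ring_morphism_poly]])
qed

lemma eval4_in:
  assumes "a \<in> R" "b \<in> R" "c \<in> R" "d \<in> R"
  shows "(\<lambda>e. eval4 p (a e) (b e) (c e) (d e)) \<in> R"
  unfolding eval4_iterated using assms by (intro eval_poly_in eval3_in ring_morphism_eval3)

end

text \<open>The offset distance \<open>d\<close> is made the innermost variable, so that specialising it acts on the
  coefficient ring of the iterated polynomial ring in \<open>x1, x2, x3\<close>.\<close>

definition eval_inner :: "complex \<times> complex \<times> complex \<times> complex \<Rightarrow> complex poly poly poly poly \<Rightarrow> complex" where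
  "eval_inner = (\<lambda>(d, x1, x2, x3) G. eval4 G x1 x2 x3 d)"

definition spec_inner :: "complex \<Rightarrow> complex poly poly poly poly \<Rightarrow> complex poly poly poly" where
  "spec_inner t = map_poly (map_poly (map_poly (\<lambda>p. poly p t)))"

lemma eval3_spec_inner: "eval3 (spec_inner t G) x1 x2 x3 = eval_inner (t, x1, x2, x3) G"
  unfolding spec_inner_def eval_inner_def prod.case eval4_iterated eval3_iterated
  by (simp add: map_poly_map_poly o_def)

lemma generic_specialisation_spec_inner: "generic_specialisation spec_inner"
  unfolding spec_inner_def
  by (intro generic_specialisation_map_poly generic_specialisation_poly)

lemma nullstellensatz_eval_inner: "hypersurface_nullstellensatz eval_inner"
proof -
  \<comment> \<open>The nested points of \<open>nullstellensatz_eval4\<close> list the innermost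
    variable first; here this is \<open>d\<close>, followed by \<open>x3\<close>, \<open>x2\<close>,
    \<open>x1\<close>.\<close>
  let ?\<phi> = "\<lambda>e :: complex \<times> complex \<times> complex \<times> complex.
    (((((), fst e), snd (snd (snd e))), fst (snd (snd e))), fst (snd e))"
  have "surj ?\<phi>"
  proof (rule surjI)
    show "?\<phi> (snd (fst (fst (fst z))), snd z, snd (fst z), snd (fst (fst z))) = z" for z
      by (simp add: prod_eq_iff)
  qed
  from hypersurface_nullstellensatz_reindex[OF nullstellensatz_eval4 this] show ?thesis
    by (simp add: eval_inner_def case_prod_unfold)
qed

lemma function_algebra_range_eval:
  fixes ev :: "'e \<Rightarrow> 'a::comm_ring_1 \<Rightarrow> complex"
  assumes "\<And>e. ring_morphism (ev e)" "\<And>c. \<exists>p. \<forall>e. ev e p = c"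
  shows "function_algebra (range (\<lambda>p e. ev e p))"
proof
  show "(\<lambda>_. c) \<in> range (\<lambda>p e. ev e p)" for c
  proof -
    obtain p where "\<forall>e. ev e p = c" using assms(2) by blast
    then have "(\<lambda>_. c) = (\<lambda>e. ev e p)" by auto
    then show ?thesis by blast
  qed
  fix a b assume "a \<in> range (\<lambda>p e. ev e p)" "b \<in> range (\<lambda>p e. ev e p)"
  then obtain p q where "a = (\<lambda>e. ev e p)" "b = (\<lambda>e. ev e q)" by auto
  then have "(\<lambda>e. a e + b e) = (\<lambda>e. ev e (p + q))" "(\<lambda>e. a e * b e) = (\<lambda>e. ev e (p * q))"
    by (auto simp: ring_morphismD[OF assms(1)])
  then show "(\<lambda>e. a e + b e) \<in> range (\<lambda>p e. ev e p)" "(\<lambda>e. a e * b e) \<in> range (\<lambda>p e. ev e p)"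
    by auto
qed

definition eval_outer :: "complex \<times> complex \<times> complex \<times> complex \<Rightarrow> complex poly poly poly poly \<Rightarrow> complex" where
  "eval_outer = (\<lambda>(d, x1, x2, x3) G. eval4 G d x1 x2 x3)"

lemma function_algebra_eval_inner: "function_algebra (range (\<lambda>G e. eval_inner e G))"
proof (rule function_algebra_range_eval)
  show "ring_morphism (eval_inner e)" for e
    using ring_morphism_eval4 by (cases e) (auto simp: eval_inner_def)
  show "\<exists>p. \<forall>e. eval_inner e p = c" for c
    by (intro exI[of _ "[:[:[:[:c:]:]:]:]"]) (auto simp: eval_inner_def eval4_def eval3_def)
qed

lemma function_algebra_eval_outer: "function_algebra (range (\<lambda>G e. eval_outer e G))"
proof (rule function_algebra_range_eval)
  show "ring_morphism (eval_outer e)" for e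
    using ring_morphism_eval4 by (cases e) (auto simp: eval_outer_def)
  show "\<exists>p. \<forall>e. eval_outer e p = c" for c
    by (intro exI[of _ "[:[:[:[:c:]:]:]:]"]) (auto simp: eval_outer_def eval4_def eval3_def)
qed

lemma coordinates_eval_inner:
  "fst \<in> range (\<lambda>G e. eval_inner e G)"
  "(\<lambda>e. fst (snd e)) \<in> range (\<lambda>G e. eval_inner e G)"
  "(\<lambda>e. fst (snd (snd e))) \<in> range (\<lambda>G e. eval_inner e G)"
  "(\<lambda>e. snd (snd (snd e))) \<in> range (\<lambda>G e. eval_inner e G)"
proof -
  show "fst \<in> range (\<lambda>G e. eval_inner e G)"
    by (rule image_eqI[of _ _ "[:[:[:[:0, 1:]:]:]:]"])
      (auto simp: eval_inner_def eval4_def eval3_def)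
  show "(\<lambda>e. fst (snd e)) \<in> range (\<lambda>G e. eval_inner e G)"
    by (rule image_eqI[of _ _ "[:0, 1:]"])
      (auto simp: eval_inner_def eval4_def eval3_def)
  show "(\<lambda>e. fst (snd (snd e))) \<in> range (\<lambda>G e. eval_inner e G)"
    by (rule image_eqI[of _ _ "[:[:0, 1:]:]"])
      (auto simp: eval_inner_def eval4_def eval3_def)
  show "(\<lambda>e. snd (snd (snd e))) \<in> range (\<lambda>G e. eval_inner e G)"
    by (rule image_eqI[of _ _ "[:[:[:0, 1:]:]:]"])
      (auto simp: eval_inner_def eval4_def eval3_def)
qed

lemma coordinates_eval_outer:
  "fst \<in> range (\<lambda>G e. eval_outer e G)"
  "(\<lambda>e. fst (snd e)) \<in> range (\<lambda>G e. eval_outer e G)"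
  "(\<lambda>e. fst (snd (snd e))) \<in> range (\<lambda>G e. eval_outer e G)"
  "(\<lambda>e. snd (snd (snd e))) \<in> range (\<lambda>G e. eval_outer e G)"
proof -
  show "fst \<in> range (\<lambda>G e. eval_outer e G)"
    by (rule image_eqI[of _ _ "[:0, 1:]"])
      (auto simp: eval_outer_def eval4_def eval3_def)
  show "(\<lambda>e. fst (snd e)) \<in> range (\<lambda>G e. eval_outer e G)"
    by (rule image_eqI[of _ _ "[:[:0, 1:]:]"])
      (auto simp: eval_outer_def eval4_def eval3_def)
  show "(\<lambda>e. fst (snd (snd e))) \<in> range (\<lambda>G e. eval_outer e G)"
    by (rule image_eqI[of _ _ "[:[:[:0, 1:]:]:]"])
      (auto simp: eval_outer_def eval4_def eval3_def)
  show "(\<lambda>e. snd (snd (snd e))) \<in> range (\<lambda>G e. eval_outer e G)"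
    by (rule image_eqI[of _ _ "[:[:[:[:0, 1:]:]:]:]"])
      (auto simp: eval_outer_def eval4_def eval3_def)
qed

text \<open>Variables are reordered without an explicit isomorphism: substituting the coordinate
  functions into \<open>g\<close> stays within the algebra of functions given by
  \<open>eval_inner\<close>.\<close>

lemma eval_outer_eq_inner: "\<exists>G. \<forall>e. eval_outer e g = eval_inner e G"
proof -
  interpret function_algebra "range (\<lambda>G e. eval_inner e G)" by (rule function_algebra_eval_inner)
  have "(\<lambda>e. eval_outer e g) \<in> range (\<lambda>G e. eval_inner e G)"
    using eval4_in[OF coordinates_eval_inner, of g] by (simp add: eval_outer_def case_prod_unfold)
  then show ?thesis by (auto simp: fun_eq_iff)
qed

lemma eval_inner_eq_outer: "\<exists>g. \<forall>e. eval_inner e G = eval_outer e g"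
proof -
  interpret function_algebra "range (\<lambda>G e. eval_outer e G)" by (rule function_algebra_eval_outer)
  have "(\<lambda>e. eval_inner e G) \<in> range (\<lambda>G e. eval_outer e G)"
    using eval4_in[OF coordinates_eval_outer(2,3,4,1), of G]
    by (simp add: eval_inner_def case_prod_unfold)
  then show ?thesis by (auto simp: fun_eq_iff)
qed

section \<open>Constructibility of the offset points\<close>

lemma (in function_algebra) constructible_offset_system:
  assumes "d \<in> R" "x1 \<in> R" "x2 \<in> R" "x3 \<in> R" "y1 \<in> R" "y2 \<in> R" "y3 \<in> R"
  shows "constructible R
    {e. \<exists>u. offset_system f (d e) (x1 e) (x2 e) (x3 e) (y1 e) (y2 e) (y3 e) u}"
proof -
  let ?y = "\<lambda>p e. eval3 p (y1 e) (y2 e) (y3 e)"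
  let ?as = "[?y f,
    \<lambda>e. ?y (pd1 f) e * (x2 e - y2 e) - ?y (pd2 f) e * (x1 e - y1 e),
    \<lambda>e. ?y (pd1 f) e * (x3 e - y3 e) - ?y (pd3 f) e * (x1 e - y1 e),
    \<lambda>e. ?y (pd2 f) e * (x3 e - y3 e) - ?y (pd3 f) e * (x2 e - y2 e),
    \<lambda>e. (x1 e - y1 e)\<^sup>2 + (x2 e - y2 e)\<^sup>2 + (x3 e - y3 e)\<^sup>2 - (d e)\<^sup>2]"
  have y: "?y p \<in> R" for p using assms by (intro eval3_in)
  have "set ?as \<subseteq> R"
    using assms by (auto intro!: y add diff mult power)
  then have "constructible R {e. (\<forall>a\<in>set ?as. a e = 0) \<and> ?y (h_imp f) e \<noteq> 0}"
    using y by (rule basic)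
  \<comment> \<open>The variable \<open>u\<close> only asserts that \<open>h_imp\<close> is nonzero,
    so it turns into the inequation of a basic set.\<close>
  moreover have "(\<exists>u. u * h - 1 = 0) \<longleftrightarrow> h \<noteq> 0" for h :: complex
    by (auto intro: exI[of _ "inverse h"])
  ultimately show ?thesis
    by (simp add: offset_system_def Let_def)
qed

definition offset_points :: "complex poly poly poly \<Rightarrow> (complex \<times> complex \<times> complex \<times> complex) set" where
  "offset_points f = {(d, x1, x2, x3). \<exists>y1 y2 y3 u. offset_system f d x1 x2 x3 y1 y2 y3 u}"

text \<open>Variables for \<open>y1\<close>, \<open>y2\<close>, \<open>y3\<close> are adjoined and
  then projected away, the last one first.\<close>

lemma constructible_offset_points:
  "constructible (range (\<lambda>G e. eval_inner e G)) (offset_points f)"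
proof -
  let ?R = "range (\<lambda>G e. eval_inner e G)"
  interpret R0: function_algebra ?R by (rule function_algebra_eval_inner)
  interpret R1: function_algebra "adjoin_var ?R" by (rule R0.function_algebra_adjoin_var)
  interpret R2: function_algebra "adjoin_var (adjoin_var ?R)"
    by (rule R1.function_algebra_adjoin_var)
  interpret R3: function_algebra "adjoin_var (adjoin_var (adjoin_var ?R))"
    by (rule R2.function_algebra_adjoin_var)
  note lift = R2.lift_in_adjoin_var[OF R1.lift_in_adjoin_var[OF R0.lift_in_adjoin_var]]
  have "constructible (adjoin_var (adjoin_var (adjoin_var ?R)))
    {z. \<exists>u. offset_system f (fst (fst (fst (fst z)))) (fst (snd (fst (fst (fst z)))))
      (fst (snd (snd (fst (fst (fst z)))))) (snd (snd (snd (fst (fst (fst z))))))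
      (snd (fst (fst z))) (snd (fst z)) (snd z) u}" (is "constructible _ ?X")
    by (rule R3.constructible_offset_system[OF coordinates_eval_inner[THEN lift]
          R2.lift_in_adjoin_var[OF R1.lift_in_adjoin_var[OF R0.var_in_adjoin_var]]
          R2.lift_in_adjoin_var[OF R1.var_in_adjoin_var] R2.var_in_adjoin_var])
  from this[THEN R2.constructible_projection, THEN R1.constructible_projection,
      THEN R0.constructible_projection]
  have "constructible ?R {e. \<exists>y1 y2 y3. (((e, y1), y2), y3) \<in> ?X}" by simp
  moreover have "{e. \<exists>y1 y2 y3. (((e, y1), y2), y3) \<in> ?X} = offset_points f"
    unfolding offset_points_def by (simp add: set_eq_iff)
  ultimately show ?thesis by simp
qed

theorem mainTheorem8:
  fixes f :: "complex poly poly poly" and g :: "complex poly poly poly poly"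
  assumes f_irred: "irreducible f"
    and h_nonzero: "\<exists>y1 y2 y3. eval3 f y1 y2 y3 = 0 \<and> eval3 (h_imp f) y1 y2 y3 \<noteq> 0"
    and g_sqfree: "squarefree g"
    and g_defines: "{(d,x1,x2,x3). eval4 g d x1 x2 x3 = 0} = generic_offset f"
  shows "\<exists>\<Delta>2 :: complex set. finite \<Delta>2 \<and>
           (\<forall>d0. d0 \<notin> \<Delta>2 \<union> {0} \<longrightarrow> zero_set3 (spec_first g d0) = offset_at f d0)"
proof -
  let ?S = "offset_points f"
  \<comment> \<open>\<open>g_defines\<close> in the form that yields both hypotheses relating
    \<open>S\<close> and \<open>G\<close> in
    \<open>constructible_contains_generic_part\<close>.\<close>
  have g_iff: "eval_outer e g = 0 \<longleftrightarrow>
      (\<forall>q. (\<forall>e'\<in>?S. eval_outer e' q = 0) \<longrightarrow> eval_outer e q = 0)" for e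
  proof -
    have "eval_outer e g = 0 \<longleftrightarrow> e \<in> generic_offset f"
      unfolding g_defines[symmetric] by (cases e) (simp add: eval_outer_def)
    also have "\<dots> \<longleftrightarrow> (\<forall>q. (\<forall>e'\<in>?S. eval_outer e' q = 0) \<longrightarrow> eval_outer e q = 0)"
      unfolding generic_offset_def zariski_closure4_def offset_points_def eval_outer_def
      by (cases e) (simp add: case_prod_unfold)
    finally show ?thesis .
  qed
  obtain G where G: "\<And>e. eval_outer e g = eval_inner e G" using eval_outer_eq_inner[of g] by blast
  have null: "hypersurface_nullstellensatz eval_inner" by (rule nullstellensatz_eval_inner)
  note hom = hypersurface_nullstellensatzD(1)[OF null]
  have "G \<noteq> 0"
  proof
    assume "G = 0"
    then have "eval4 g d x1 x2 x3 = 0" for d x1 x2 x3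
      using G[of "(d, x1, x2, x3)"] ring_morphism_0[OF hom] by (simp add: eval_outer_def)
    moreover have "g \<noteq> 0" using g_sqfree by auto
    ultimately show False
      using eval4_nonzero by blast
  qed
  have S_G: "eval_inner e G = 0" if "e \<in> ?S" for e
    using that unfolding G[symmetric] g_iff by blast
  have closure: "eval_inner e q = 0"
    if q: "\<And>e. e \<in> ?S \<Longrightarrow> eval_inner e q = 0" and "eval_inner e G = 0" for q e
  proof -
    obtain q' where q': "\<And>e. eval_inner e q = eval_outer e q'" using eval_inner_eq_outer[of q] by blast
    have "\<forall>e'\<in>?S. eval_outer e' q' = 0" using q by (simp add: q')
    moreover have "eval_outer e g = 0" using that(2) by (simp add: G)
    ultimately have "eval_outer e q' = 0" unfolding g_iff by blast
    then show ?thesis by (simp add: q')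
  qed
  have "\<forall>p\<in>prime_factors G. \<exists>b. \<not> p dvd b \<and>
      (\<forall>e. eval_inner e p = 0 \<and> eval_inner e b \<noteq> 0 \<longrightarrow> e \<in> ?S)"
    by (intro ballI constructible_contains_generic_part
        [OF null constructible_offset_points \<open>G \<noteq> 0\<close> S_G closure])
  from bchoice[OF this] obtain b where b: "\<And>p. p \<in> prime_factors G \<Longrightarrow> \<not> p dvd b p"
    and b_S: "\<And>p e. p \<in> prime_factors G \<Longrightarrow> eval_inner e p = 0 \<Longrightarrow> eval_inner e (b p) \<noteq> 0 \<Longrightarrow> e \<in> ?S"
    by blast
  have spec: "generic_specialisation spec_inner" by (rule generic_specialisation_spec_inner)
  \<comment> \<open>There are finitely many prime factors, and each excludes only finitely many
    \<open>t\<close>: \<open>p\<close> and \<open>b p\<close> are coprime because \<open>p\<close>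
    is irreducible and does not divide \<open>b p\<close>.\<close>
  have "\<forall>\<^sub>F t in cofinite. \<forall>p\<in>prime_factors G.
      spec_inner t p \<noteq> 0 \<and> no_common_irreducible (spec_inner t ` {p, b p})"
  proof (intro eventually_ball_finite ballI eventually_conj)
    fix p assume p: "p \<in> prime_factors G"
    then have "irreducible p" by (auto simp: in_prime_factors_iff prime_elem_imp_irreducible)
    then show "\<forall>\<^sub>F t in cofinite. no_common_irreducible (spec_inner t ` {p, b p})"
      using b[OF p] by (intro generic_specialisationD(3)[OF spec] no_common_irreducible_pair) auto
    have "p \<noteq> 0" using p by auto
    then show "\<forall>\<^sub>F t in cofinite. spec_inner t p \<noteq> 0"
      by (rule generic_specialisationD(2)[OF spec])
  qed simp
  moreover have "zero_set3 (spec_first g t) = offset_at f t"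
    if gen: "\<forall>p\<in>prime_factors G.
      spec_inner t p \<noteq> 0 \<and> no_common_irreducible (spec_inner t ` {p, b p})" for t
  proof -
    have S_t: "offset_at f t = zariski_closure3 {(x1, x2, x3). (t, x1, x2, x3) \<in> ?S}"
      by (simp add: offset_at_def offset_points_def)
    have g_t: "eval3 (spec_first g t) x1 x2 x3 = eval_inner (t, x1, x2, x3) G" for x1 x2 x3
      using G[of "(t, x1, x2, x3)"] by (simp add: eval_outer_def eval4_def spec_first_def)
    have "eval3 q x1 x2 x3 = 0" if Gx: "eval_inner (t, x1, x2, x3) G = 0"
      and q: "\<And>x1 x2 x3. (t, x1, x2, x3) \<in> ?S \<Longrightarrow> eval3 q x1 x2 x3 = 0" for q x1 x2 x3
    proof -
      obtain p where p: "p \<in> prime_factors G" "eval_inner (t, x1, x2, x3) p = 0"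
        using zero_of_prime_factor[OF hom \<open>G \<noteq> 0\<close> Gx] .
      have "eval3 (spec_inner t p) x1 x2 x3 = 0" using p(2) by (simp add: eval3_spec_inner)
      \<comment> \<open>\<open>p\<close> may become reducible after specialisation, so an
        irreducible factor \<open>P\<close> vanishing at the given point is used.\<close>
      then obtain P where P: "P \<in> prime_factors (spec_inner t p)" "eval3 P x1 x2 x3 = 0"
        using zero_of_prime_factor[OF ring_morphism_eval3, of "spec_inner t p"] gen p(1) by blast
      then have Pe: "prime_elem P" "irreducible P" and P_p: "P dvd spec_inner t p"
        by (auto simp: in_prime_factors_iff prime_elem_imp_irreducible)
      then have P_b: "\<not> P dvd spec_inner t (b p)"
        using gen p(1) unfolding no_common_irreducible_def by auto
      \<comment> \<open>A zero of \<open>P\<close> at which the specialised \<open>b p\<close> does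
        not vanish lies in the slice of the offset points, where \<open>q\<close> vanishes. So the
        product vanishes on the whole zero set of \<open>P\<close>.\<close>
      have "P dvd q * spec_inner t (b p)"
      proof (rule ccontr)
        assume "\<not> ?thesis"
        then obtain z1 z2 z3 where z: "eval3 P z1 z2 z3 = 0"
          "eval3 (q * spec_inner t (b p)) z1 z2 z3 \<noteq> 0"
          using irreducible_not_dvd_eval3[OF Pe(2)] by blast
        have "eval_inner (t, z1, z2, z3) p = 0"
          using ring_morphism_dvd[OF ring_morphism_eval3 P_p, of z1 z2 z3] z(1)
          by (simp add: eval3_spec_inner)
        moreover have "eval_inner (t, z1, z2, z3) (b p) \<noteq> 0" "eval3 q z1 z2 z3 \<noteq> 0"
          using z(2) by (auto simp: ring_morphismD[OF ring_morphism_eval3] eval3_spec_inner)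
        ultimately show False using b_S[OF p(1)] q by blast
      qed
      then have "P dvd q" using P_b Pe(1) by (simp add: prime_elem_dvd_mult_iff)
      then show ?thesis
        using ring_morphism_dvd[OF ring_morphism_eval3, of P q x1 x2 x3] P(2) by simp
    qed
    then have "zero_set3 (spec_first g t) \<subseteq> offset_at f t"
      unfolding S_t zero_set3_def zariski_closure3_def by (auto simp: g_t)
    moreover have "eval3 (spec_first g t) x1 x2 x3 = 0" if "(t, x1, x2, x3) \<in> ?S" for x1 x2 x3
      using S_G[OF that] by (simp add: g_t)
    then have "offset_at f t \<subseteq> zero_set3 (spec_first g t)"
      unfolding S_t zero_set3_def zariski_closure3_def by auto
    ultimately show ?thesis by blast
  qed
  ultimately have "\<forall>\<^sub>F t in cofinite. zero_set3 (spec_first g t) = offset_at f t"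
    by (rule eventually_mono)
  \<comment> \<open>The set of failures itself serves as the exceptional set.\<close>
  then have "finite {t. zero_set3 (spec_first g t) \<noteq> offset_at f t}"
    unfolding eventually_cofinite .
  then show ?thesis
    by (intro exI[of _ "{t. zero_set3 (spec_first g t) \<noteq> offset_at f t}"]) simp
qed

end
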